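(* Let $a,b$ be integers with $0<a<b$ and suppose that $b$ is not a multiple of $a$. Let $[a_0,a_1,\dots,a_n]$ be the continued fraction expansion of $\frac{b}{a}$ (with $a_n>1$), and let $\mathcal{J}(a,b)$ be the largest nonnegative integer $j<n$ such that $a_0=\dots=a_{j-1}\leq a_j$. Then the Sprague-Grundy function $\mathcal{G}_M$ of the game M-Euclid satisfies \[ \mathcal{G}_M(a,b)=\left\lfloor \frac{b}{a}\right\rfloor-\begin{cases}0, & \text{if } \mathcal{J}(a,b)\text{ is even},\\ 1, & \text{otherwise}.\end{cases} \]
   Context: M-Euclid is the following two-player impartial combinatorial game. A position is an (unordered) pair of positive integers. The players move alternately; a move consists of subtracting a positive integer multiple of one of the entries from the other entry, without making the result negative. The game stops when one of the entries is a positive integer multiple of the other (in particular when the entries are equal): such positions are terminal, with no moves available. The player who makes the last move wins. The Sprague-Grundy function $\mathcal{G}_M$ is defined recursively: $\mathcal{G}_M(p)$ is the least nonnegative integer not in the set $\{\mathcal{G}_M(q): q \text{ is reachable from } p \text{ in one move}\}$; in particular it is $0$ at terminal positions. Continued fractions: $[a_0,a_1,\dots,a_n]=a_0+\cfrac{1}{a_1+\cfrac{1}{\ddots+\cfrac{1}{a_n}}}$ with positive integers $a_i$, and with the convention that $a_n>1$ if $n>0$, so that the expansion of a rational number $b/a>1$ is unique. Since $b$ is not a multiple of $a$, here $n\geq 1$. The condition $a_0=\dots=a_{j-1}\leq a_j$ is vacuously true for $j=0$, for $j=1$ it means $a_0\le a_1$, and for $j\geq 2$ it means $a_0=a_1=\dots=a_{j-1}$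 and $a_{j-1}\leq a_j$. *)

theory Defs
  imports Complex_Main "HOL-Library.Uprod"
begin

section \<open>Sprague-Grundy functions\<close>

definition mex :: "nat set \<Rightarrow> nat" where
  "mex A = (LEAST n. n \<notin> A)"

text \<open>\<open>move p q\<close> means that \<open>q\<close> is reachable from \<open>p\<close> in one move.  The recursion is
  meaningful only if no infinite play exists.\<close>

definition sprague_grundy :: "('p \<Rightarrow> 'p \<Rightarrow> bool) \<Rightarrow> 'p \<Rightarrow> nat" where
  "sprague_grundy move = wfrec {(q, p). move p q} (\<lambda>G p. mex (G ` {q. move p q}))"

lemma sprague_grundy_rec:
  assumes "wf {(q, p). move p q}"
  shows "sprague_grundy move p = mex (sprague_grundy move ` {q. move p q})"
proof -
  have "sprague_grundy move p =
      mex (cut (sprague_grundy move) {(q, p). move p q} p ` {q. move p q})"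
    unfolding sprague_grundy_def by (subst wfrec[OF assms]) simp
  also have "cut (sprague_grundy move) {(q, p). move p q} p ` {q. move p q} =
      sprague_grundy move ` {q. move p q}"
    by (rule image_cong) (simp_all add: cut_apply)
  finally show ?thesis .
qed


section \<open>The game M-Euclid\<close>

text \<open>Positions are the unordered pairs \<open>Upair a b\<close> with \<open>a\<close> and \<open>b\<close> positive.  Since
  \<open>Upair a b = Upair b a\<close>, the definitions below cover both orders of the entries.\<close>

definition m_terminal :: "nat uprod \<Rightarrow> bool" where
  "m_terminal p \<longleftrightarrow> (\<exists>a b. p = Upair a b \<and> a dvd b)"

inductive m_move :: "nat uprod \<Rightarrow> nat uprod \<Rightarrow> bool" where
  "\<lbrakk>0 < a; 0 < b; \<not> m_terminal (Upair a b); 0 < k; k * a \<le> b\<rbrakk>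
    \<Longrightarrow> m_move (Upair a b) (Upair a (b - k * a))"

text \<open>The result of a move is again a pair of positive integers.\<close>

lemma m_move_pos:
  assumes "m_move p q"
  shows "0 \<notin> set_uprod q"
  using assms
proof cases
  case (1 a b k)
  have "k * a \<noteq> b"
    using 1 unfolding m_terminal_def by (metis dvd_triv_right)
  then show ?thesis
    using 1 by simp
qed

lemma wf_m_move: "wf {(q, p). m_move p q}"
proof (rule wf_subset)
  let ?sum = "case_uprod (Abs_commute (+)) :: nat uprod \<Rightarrow> nat"
  have sum: "?sum (Upair a b) = a + b" for a b
    by (simp add: Abs_commute_inverse add.commute)
  show "wf (measure ?sum)"
    by simp
  show "{(q, p). m_move p q} \<subseteq> measure ?sum"
  proof clarify
    fix q p
    assume "m_move p q"
    then show "(q, p) \<in> measure ?sum"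
      by cases (simp add: sum del: case_uprod_simps)
  qed
qed

definition G_M :: "nat \<Rightarrow> nat \<Rightarrow> nat" where
  "G_M a b = sprague_grundy m_move (Upair a b)"


section \<open>Continued fractions\<close>

text \<open>The empty list has the dummy value \<open>0\<close>.\<close>

fun cfrac :: "nat list \<Rightarrow> rat" where
  "cfrac [] = 0"
| "cfrac [c] = of_nat c"
| "cfrac (c # d # cs) = of_nat c + 1 / cfrac (d # cs)"

definition is_cfrac_expansion :: "nat list \<Rightarrow> rat \<Rightarrow> bool" where
  "is_cfrac_expansion cs x \<longleftrightarrow>
     cs \<noteq> [] \<and> (\<forall>c \<in> set cs. 0 < c) \<and> (1 < length cs \<longrightarrow> 1 < last cs) \<and> cfrac cs = x"

lemma cfrac_gt_1:
  assumes "cs \<noteq> []" "\<forall>c \<in> set cs. 0 < c" "1 < last cs"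
  shows "1 < cfrac cs"
  using assms
proof (induction cs rule: cfrac.induct)
  case (3 c d cs)
  then have "1 < cfrac (d # cs)" by simp
  then have "0 < 1 / cfrac (d # cs)" by simp
  moreover have "1 \<le> (of_nat c :: rat)" using 3 by simp
  ultimately show ?case by (simp only: cfrac.simps)
qed simp_all

lemma cfrac_expansion_exists:
  assumes "0 < a" "a \<le> b"
  shows "\<exists>cs. is_cfrac_expansion cs (of_nat b / of_nat a)"
  using assms
proof (induction a arbitrary: b rule: less_induct)
  case (less a)
  define q r where "q = b div a" and "r = b mod a"
  have b: "b = q * a + r" and q: "0 < q"
    using less.prems by (auto simp: q_def r_def div_greater_zero_iff)
  show ?case
  proof (cases "r = 0")
    case True
    then have "is_cfrac_expansion [q] (of_nat b / of_nat a)"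
      using b q less.prems by (simp add: is_cfrac_expansion_def)
    then show ?thesis ..
  next
    case False
    then have r: "0 < r" "r < a"
      using less.prems by (simp_all add: r_def)
    from less.IH[OF r(2) r(1), of a] r(2) obtain cs
      where cs: "is_cfrac_expansion cs (of_nat a / of_nat r)"
      by auto
    then obtain d ds where ds: "cs = d # ds"
      by (cases cs) (auto simp: is_cfrac_expansion_def)
    have last: "1 < last cs"
    proof (cases ds)
      case Nil
      then have "(of_nat d :: rat) = of_nat a / of_nat r"
        using cs ds by (simp add: is_cfrac_expansion_def)
      also have "\<dots> > 1" using r by simp
      finally show ?thesis using ds Nil by simp
    next
      case Cons
      then show ?thesis using cs ds by (simp add: is_cfrac_expansion_def)
    qed
    have "cfrac (q # cs) = of_nat q + 1 / (of_nat a / of_nat r)"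
      using cs ds by (simp add: is_cfrac_expansion_def)
    also have "\<dots> = of_nat b / of_nat a"
      using r less.prems by (simp add: b field_simps)
    finally have "is_cfrac_expansion (q # cs) (of_nat b / of_nat a)"
      using cs q last by (auto simp: is_cfrac_expansion_def)
    then show ?thesis ..
  qed
qed

lemma cfrac_expansion_floor:
  assumes "is_cfrac_expansion (c # cs) x"
  shows "\<lfloor>x\<rfloor> = int c"
proof (cases cs)
  case Nil
  then show ?thesis using assms by (auto simp: is_cfrac_expansion_def)
next
  case (Cons d ds)
  then have "1 < cfrac cs"
    using assms by (intro cfrac_gt_1) (auto simp: is_cfrac_expansion_def)
  moreover have "x = of_nat c + 1 / cfrac cs"
    using assms Cons by (simp add: is_cfrac_expansion_def)
  ultimately show ?thesis by (simp add: floor_eq_iff)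
qed

lemma cfrac_expansion_unique:
  assumes "is_cfrac_expansion cs x" "is_cfrac_expansion ds x"
  shows "cs = ds"
  using assms
proof (induction cs arbitrary: ds x)
  case Nil
  then show ?case by (simp add: is_cfrac_expansion_def)
next
  case (Cons c cs)
  then obtain d ds' where ds: "ds = d # ds'"
    by (cases ds) (auto simp: is_cfrac_expansion_def)
  have cd: "c = d"
    using cfrac_expansion_floor[of c cs x] cfrac_expansion_floor[of d ds' x] Cons.prems ds
    by simp
  have tail: "1 < cfrac es \<and> x = of_nat e + 1 / cfrac es \<and> is_cfrac_expansion es (cfrac es)"
    if "is_cfrac_expansion (e # es) x" "es \<noteq> []" for e es
  proof -
    from that(2) obtain f fs where "es = f # fs" by (cases es) auto
    then show ?thesis
      using that cfrac_gt_1[of es] by (auto simp: is_cfrac_expansion_def)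
  qed
  have nil: "x = of_nat e" if "is_cfrac_expansion [e] x" for e
    using that by (simp add: is_cfrac_expansion_def)
  show ?case
  proof (cases "cs = []"; cases "ds' = []")
    assume "cs \<noteq> []" "ds' \<noteq> []"
    then have *: "1 < cfrac cs" "x = of_nat c + 1 / cfrac cs" "is_cfrac_expansion cs (cfrac cs)"
      "1 < cfrac ds'" "x = of_nat d + 1 / cfrac ds'" "is_cfrac_expansion ds' (cfrac ds')"
      using tail Cons.prems ds by blast+
    then have "cfrac cs = cfrac ds'" using cd by simp
    then show ?thesis using Cons.IH[of "cfrac cs" ds'] * ds cd by simp
  next
    assume "cs = []" "ds' \<noteq> []"
    then show ?thesis using tail[of d ds'] nil[of c] Cons.prems ds cd by auto
  next
    assume "cs \<noteq> []" "ds' = []"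
    then show ?thesis using tail[of c cs] nil[of d] Cons.prems ds cd by auto
  next
    assume "cs = []" "ds' = []"
    then show ?thesis using ds cd by simp
  qed
qed

text \<open>For \<open>cs = [c\<^sub>0, \<dots>, c\<^sub>n]\<close>, the largest \<open>j < n\<close> with
  \<open>c\<^sub>0 = \<dots> = c\<^bsub>j-1\<^esub> \<le> c\<^sub>j\<close>.  The set contains \<open>0\<close> whenever \<open>n \<ge> 1\<close>.\<close>

definition J_index :: "nat list \<Rightarrow> nat" where
  "J_index cs = Max {j. j < length cs - 1 \<and>
     (\<forall>i < j. cs ! i = cs ! 0) \<and> (0 < j \<longrightarrow> cs ! (j - 1) \<le> cs ! j)}"

end

theory Submission
  imports Defs
begin

text \<open>Write \<open>b = q * a + r\<close> with \<open>0 < r < a\<close>.  A multiple of \<open>b\<close> is too large to be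
  subtracted from \<open>a\<close>, so the moves from \<open>(a, b)\<close> lead exactly to the positions
  \<open>(a, i * a + r)\<close> with \<open>i < q\<close>: a ladder whose bottom rung \<open>(a, r)\<close> has some value \<open>g\<close>, and
  in which every higher rung can move to every rung below it.  Hence the rungs \<open>1, 2, \<dots>\<close> take
  the values \<open>0, 1, 2, \<dots>\<close> in order, skipping \<open>g\<close>; so rung \<open>q\<close> has value \<open>q - 1\<close> if
  \<open>q \<le> g\<close>, and \<open>q\<close> otherwise (\<open>G_M_ladder\<close>).

  Here \<open>q\<close> is the first partial quotient \<open>c\<^sub>0\<close> of \<open>b / a\<close>, and the bottom rung has the tail
  of the continued fraction as its expansion (\<open>cfrac_expansion_step\<close>).  If this tail is the
  single entry \<open>c\<^sub>1\<close>, the bottom rung is terminal, \<open>g = 0\<close>, and there is no correction, in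
  accordance with \<open>J = 0\<close>.  For a longer tail, \<open>g\<close> is by induction \<open>c\<^sub>1\<close> or \<open>c\<^sub>1 - 1\<close>,
  according to the parity of the index of the tail.  Thus \<open>c\<^sub>0 > c\<^sub>1\<close> gives no correction,
  \<open>c\<^sub>0 < c\<^sub>1\<close> gives the correction \<open>1\<close>, and for \<open>c\<^sub>0 = c\<^sub>1\<close> the correction is the opposite
  of the one for the tail.  The parity of \<open>J\<close> obeys the same rules, because in these cases \<open>J\<close>
  is respectively \<open>0\<close>, \<open>1\<close>, and one more than the index of the tail
  (\<open>J_index_Cons_Cons\<close>).\<close>

lemma mex_eqI:
  assumes "n \<notin> A" and "\<And>m. m < n \<Longrightarrow> m \<in> A"
  shows "mex A = n"
  unfolding mex_def using assms by (intro Least_equality) (auto simp: not_less[symmetric])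

lemma G_M_commute: "G_M a b = G_M b a"
  unfolding G_M_def by (rule arg_cong[of "Upair a b" "Upair b a"]) (simp add: Upair_inject)

lemma G_M_eq_mex: "G_M a b = mex (sprague_grundy m_move ` {p. m_move (Upair a b) p})"
  unfolding G_M_def by (rule sprague_grundy_rec[OF wf_m_move])

lemma m_terminal_Upair: "m_terminal (Upair a b) \<longleftrightarrow> a dvd b \<or> b dvd a"
  unfolding m_terminal_def by (auto simp: Upair_inject)

lemma G_M_dvd:
  assumes "a dvd b"
  shows "G_M a b = 0"
proof -
  have "\<not> m_move (Upair a b) p" for p
  proof
    assume "m_move (Upair a b) p"
    then show False
      using assms by cases (auto simp: m_terminal_Upair Upair_inject)
  qed
  then show ?thesis
    unfolding G_M_eq_mex by (intro mex_eqI) auto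
qed

text \<open>The condition \<open>0 < q\<close> keeps off the bottom rung: there \<open>r\<close> is the smaller entry, and
  the moves change \<open>a\<close>.\<close>

lemma m_move_ladder:
  fixes a q r :: nat
  assumes "0 < r" "r < a" "0 < q"
  shows "{p. m_move (Upair a (q * a + r)) p} = (\<lambda>i. Upair a (i * a + r)) ` {..<q}"
proof (intro equalityI subsetI)
  have "a \<le> q * a" using assms by simp
  then have less: "a < q * a + r" using assms(1) by linarith
  have "\<not> a dvd r"
    using assms by (auto dest: dvd_imp_le)
  then have nt: "\<not> m_terminal (Upair a (q * a + r))"
    using less assms by (auto simp: m_terminal_Upair dest: dvd_imp_le)
  {
    fix p assume "p \<in> {p. m_move (Upair a (q * a + r)) p}"
    then have "m_move (Upair a (q * a + r)) p" by simp
    then show "p \<in> (\<lambda>i. Upair a (i * a + r)) ` {..<q}"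
    proof cases
      case (1 x y k)
      have "x \<le> k * x" using \<open>0 < k\<close> by simp
      then have "x \<le> y" using \<open>k * x \<le> y\<close> by linarith
      then have xy: "x = a" "y = q * a + r"
        using less 1(1) by (auto simp: Upair_inject)
      have "k * a < Suc q * a"
        using \<open>k * x \<le> y\<close> xy assms(2) by simp
      then have "k \<le> q"
        by (simp only: mult_less_cancel2 less_Suc_eq_le)
      then have "y - k * x = (q - k) * a + r"
        using xy by (simp add: diff_mult_distrib)
      then show ?thesis
        using 1 xy assms by (auto intro!: image_eqI[of _ _ "q - k"])
    qed
  next
    fix p assume "p \<in> (\<lambda>i. Upair a (i * a + r)) ` {..<q}"
    then obtain i where i: "i < q" "p = Upair a (i * a + r)" by auto
    have "i * a \<le> q * a" using i by simp
    then have "q * a + r - (q - i) * a = i * a + r"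
      by (simp add: diff_mult_distrib)
    moreover have "(q - i) * a \<le> q * a + r"
      by (simp add: diff_mult_distrib)
    moreover have "0 < a" using assms by simp
    ultimately show "p \<in> {p. m_move (Upair a (q * a + r)) p}"
      using m_move.intros[of a "q * a + r" "q - i"] i nt less by simp
  }
qed

text \<open>Since each rung moves to all lower ones, its value is the least number not yet taken; the
  number taken by the bottom rung is the only one skipped.\<close>

lemma G_M_ladder:
  fixes a q r :: nat
  assumes "0 < r" "r < a" "0 < q"
  shows "G_M a (q * a + r) = (if q \<le> G_M a r then q - 1 else q)"
  using assms(3)
proof (induction q rule: less_induct)
  case (less q)
  let ?g = "G_M a r"
  let ?V = "(\<lambda>i. G_M a (i * a + r)) ` {..<q}"
  have G: "G_M a (q * a + r) = mex ?V"
    unfolding G_M_eq_mex[of a "q * a + r"] m_move_ladder[OF assms(1,2) less.prems]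
    by (simp add: image_image G_M_def)
  have rung: "G_M a (i * a + r) = (if i = 0 then ?g else if i \<le> ?g then i - 1 else i)"
    if "i < q" for i
    using less.IH[of i] that by auto
  show ?case
  proof (cases "q \<le> ?g")
    case True
    have "mex ?V = q - 1"
    proof (rule mex_eqI)
      show "q - 1 \<notin> ?V"
        using True less.prems by (auto simp: rung split: if_splits)
      show "m \<in> ?V" if "m < q - 1" for m
        using that True by (intro image_eqI[of _ _ "Suc m"]) (auto simp: rung simp del: mult_Suc)
    qed
    then show ?thesis using G True by simp
  next
    case False
    have "mex ?V = q"
    proof (rule mex_eqI)
      show "q \<notin> ?V"
        using False by (auto simp: rung split: if_splits)
      show "m \<in> ?V" if "m < q" for m
      proof -
        \<comment> \<open>The value \<open>m\<close> sits at the bottom, at rung \<open>m + 1\<close> before the skipped value, or at rung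
          \<open>m\<close> after it.\<close>
        let ?i = "if m = ?g then 0 else if m < ?g then Suc m else m"
        show ?thesis
          using that False
          by (intro image_eqI[of _ _ ?i]) (auto simp: rung simp del: mult_Suc)
      qed
    qed
    then show ?thesis using G False by simp
  qed
qed

lemma J_index_pair: "J_index [c, d] = 0"
proof -
  have "{j. j < length [c, d] - 1 \<and> (\<forall>i < j. [c, d] ! i = [c, d] ! 0) \<and>
      (0 < j \<longrightarrow> [c, d] ! (j - 1) \<le> [c, d] ! j)} = {0}"
    by auto
  then show ?thesis unfolding J_index_def by simp
qed

text \<open>An index \<open>j \<ge> 2\<close> is admissible for the whole list iff its first two entries agree and
  \<open>j - 1\<close> is admissible for the tail.\<close>

lemma J_index_Cons_Cons:
  assumes "es \<noteq> []"
  shows "J_index (c # d # es) =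
    (if d < c then 0 else if c < d then 1 else Suc (J_index (d # es)))"
proof -
  define S :: "nat list \<Rightarrow> nat set" where
    "S cs = {j. j < length cs - 1 \<and> (\<forall>i < j. cs ! i = cs ! 0) \<and>
      (0 < j \<longrightarrow> cs ! (j - 1) \<le> cs ! j)}" for cs
  have J: "J_index cs = Max (S cs)" for cs
    by (simp add: J_index_def S_def)
  have fin: "finite (S cs)" for cs
    unfolding S_def by (rule finite_subset[of _ "{..<length cs}"]) auto
  have zero: "0 \<in> S (x # d # es)" "0 \<in> S (d # es)" for x
    using assms by (simp_all add: S_def)
  have one: "Suc 0 \<in> S (c # d # es) \<longleftrightarrow> c \<le> d"
    using assms by (simp add: S_def)
  have two: "Suc (Suc i) \<in> S (c # d # es) \<longleftrightarrow> c = d \<and> Suc i \<in> S (d # es)" for i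
    by (auto simp: S_def All_less_Suc2)
  show ?thesis
  proof (cases c d rule: linorder_cases)
    case less
    have "S (c # d # es) = {0, 1}"
    proof (rule set_eqI)
      show "j \<in> S (c # d # es) \<longleftrightarrow> j \<in> {0, 1}" for j
        using less zero one two[of "j - 2"] by (cases j rule: nat.exhaust; cases "j - 1") auto
    qed
    then show ?thesis using less by (simp add: J)
  next
    case greater
    have "S (c # d # es) = {0}"
    proof (rule set_eqI)
      show "j \<in> S (c # d # es) \<longleftrightarrow> j \<in> {0}" for j
        using greater zero one two[of "j - 2"] by (cases j rule: nat.exhaust; cases "j - 1") auto
    qed
    then show ?thesis using greater by (simp add: J)
  next
    case equal
    have "S (c # d # es) = insert 0 (Suc ` S (d # es))"
    proof (rule set_eqI)
      show "j \<in> S (c # d # es) \<longleftrightarrow> j \<in> insert 0 (Suc ` S (d # es))" for j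
        using equal zero one two[of "j - 2"] by (cases j rule: nat.exhaust; cases "j - 1") auto
    qed
    moreover have "Max (Suc ` S (d # es)) = Suc (Max (S (d # es)))"
      using fin zero(2) by (intro mono_Max_commute[symmetric]) (auto simp: mono_def)
    moreover have "Max (insert 0 (Suc ` S (d # es))) = max 0 (Max (Suc ` S (d # es)))"
      using fin zero(2) by (intro Max_insert) auto
    ultimately show ?thesis
      using equal by (simp add: J)
  qed
qed

text \<open>The tail of a continued fraction expands the pair produced by one step of Euclid's
  algorithm; this matches passing to the bottom of the ladder.\<close>

lemma cfrac_expansion_step:
  fixes a b :: nat
  assumes "0 < a" "\<not> a dvd b" "is_cfrac_expansion (c # cs) (of_nat b / of_nat a)"
  shows "b div a = c" and "is_cfrac_expansion cs (of_nat a / of_nat (b mod a))"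
proof -
  have "\<lfloor>of_nat b / of_nat a :: rat\<rfloor> = int (b div a)"
    by (simp add: floor_divide_of_nat_eq)
  then show c: "b div a = c"
    using cfrac_expansion_floor[OF assms(3)] by simp
  have b: "of_nat b = of_nat c * (of_nat a :: rat) + of_nat (b mod a)"
    using c by (metis div_mult_mod_eq of_nat_add of_nat_mult)
  have r: "0 < b mod a" using assms(2) by (auto simp: dvd_eq_mod_eq_0)
  have "cs \<noteq> []"
  proof
    assume "cs = []"
    then have "of_nat c = (of_nat b / of_nat a :: rat)"
      using assms(3) by (simp add: is_cfrac_expansion_def)
    then have "of_nat c * of_nat a = (of_nat b :: rat)"
      using assms(1) by (simp add: field_simps)
    then have "of_nat (b mod a) = (0 :: rat)" using b by simp
    then show False using r by simp
  qed
  then obtain d ds where cs: "cs = d # ds" by (cases cs) auto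
  have "of_nat c + 1 / cfrac cs = (of_nat b / of_nat a :: rat)"
    using assms(3) cs by (simp add: is_cfrac_expansion_def)
  also have "\<dots> = of_nat c + of_nat (b mod a) / of_nat a"
    using assms(1) by (subst b) (simp add: field_simps)
  finally have "inverse (cfrac cs) = inverse (of_nat a / of_nat (b mod a))"
    by (simp add: field_simps)
  then have "cfrac cs = of_nat a / of_nat (b mod a)"
    by (simp only: inverse_eq_iff_eq)
  then show "is_cfrac_expansion cs (of_nat a / of_nat (b mod a))"
    using assms(3) cs by (auto simp: is_cfrac_expansion_def)
qed

text \<open>Natural subtraction is harmless here, as the first partial quotient is positive.\<close>

lemma G_M_cfrac:
  fixes a b :: nat
  assumes "0 < a" "a < b" "\<not> a dvd b" "is_cfrac_expansion cs (of_nat b / of_nat a)"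
  shows "G_M a b = hd cs - (if even (J_index cs) then 0 else 1)"
  using assms
proof (induction cs arbitrary: a b)
  case Nil
  then show ?case by (simp add: is_cfrac_expansion_def)
next
  case (Cons c cs)
  define r where "r = b mod a"
  have c: "b div a = c" and tail: "is_cfrac_expansion cs (of_nat a / of_nat r)"
    using cfrac_expansion_step[OF Cons.prems(1,3,4)] by (simp_all add: r_def)
  have r: "0 < r" "r < a"
    using Cons.prems by (auto simp: r_def dvd_eq_mod_eq_0)
  have "0 < c" using Cons.prems by (simp add: is_cfrac_expansion_def)
  moreover have "b = c * a + r" using c by (auto simp: r_def)
  ultimately have G: "G_M a b = (if c \<le> G_M r a then c - 1 else c)"
    using G_M_ladder[OF r, of c] G_M_commute[of a r] by simp
  obtain d ds where cs: "cs = d # ds"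
    using tail by (cases cs) (auto simp: is_cfrac_expansion_def)
  have "0 < d" using tail cs by (simp add: is_cfrac_expansion_def)
  have "r dvd a \<longleftrightarrow> ds = []"
  proof
    assume "ds = []"
    then have "of_nat d = (of_nat a / of_nat r :: rat)"
      using tail cs by (simp add: is_cfrac_expansion_def)
    then have "(of_nat (d * r) :: rat) = of_nat a"
      using r by (simp add: field_simps)
    then have "d * r = a" by (simp only: of_nat_eq_iff)
    then show "r dvd a" by auto
  next
    assume "r dvd a"
    then obtain k where "a = r * k" ..
    then have "is_cfrac_expansion [k] (of_nat a / of_nat r)"
      using r by (simp add: is_cfrac_expansion_def)
    from cfrac_expansion_unique[OF this tail] show "ds = []" using cs by simp
  qed
  show ?case
  proof (cases "ds = []")
    case True
    then have "G_M r a = 0" using \<open>r dvd a \<longleftrightarrow> ds = []\<close> G_M_dvd by simp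
    then show ?thesis
      using G \<open>0 < c\<close> True cs by (simp add: J_index_pair)
  next
    case False
    then have "G_M r a = d - (if even (J_index cs) then 0 else 1)"
      using Cons.IH[OF r _ tail] \<open>r dvd a \<longleftrightarrow> ds = []\<close> cs by simp
    then show ?thesis
      using G \<open>0 < c\<close> \<open>0 < d\<close> J_index_Cons_Cons[OF False, of c d] cs
      by (cases c d rule: linorder_cases) auto
  qed
qed

theorem theorem2:
  fixes a b :: nat and cs :: "nat list"
  assumes "0 < a" and "a < b" and "\<not> a dvd b"
    and "is_cfrac_expansion cs (of_nat b / of_nat a)"
  shows "int (G_M a b) =
    \<lfloor>(of_nat b / of_nat a :: rat)\<rfloor> - (if even (J_index cs) then 0 else 1)"
proof -
  obtain c ds where cs: "cs = c # ds"
    using assms(4) by (cases cs) (auto simp: is_cfrac_expansion_def)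
  have "\<lfloor>(of_nat b / of_nat a :: rat)\<rfloor> = int c"
    using cfrac_expansion_floor assms(4) unfolding cs .
  moreover have "0 < c"
    using assms(4) cs by (simp add: is_cfrac_expansion_def)
  ultimately show ?thesis
    using G_M_cfrac[OF assms] cs by simp
qed

end
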